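(* Let $n\ge 3$. The number of permutations of size $n$ that are not in $Av_n(213;2)$ is $$|\mathcal{S}_n\setminus Av(213;2)| = 2 (n-2)! \left( \sum_{i=1}^{n-4} \frac{c_i}{(i-1)!} \right) + 2 (n-2)(n-3)\, c_{n-3} + 2 (n-2)\, c_{n-2} - c_n + 2 c_{n-1},$$ where $c_n=\frac{1}{n+1}\binom{2n}{n}$ is the $n$-th Catalan number (and an empty sum is $0$).
   Context: $\mathcal{S}_n$ is the set of permutations $\pi=\pi_1\pi_2\dots\pi_n$ of $\{1,\dots,n\}$ in one-line notation. Write $\sigma\prec\pi$ if $\pi$ contains the pattern $\sigma$ in the classical sense (some subsequence of $\pi$, not necessarily consecutive, is order-isomorphic to $\sigma$), and $\sigma\nprec\pi$ otherwise. For an entry $k$ of $\pi$, let $s_\pi(k)$ be the biggest sub-string (block of consecutive positions) of $\pi$ that contains the entry $k$ and all of whose entries are greater than or equal to $k$. The sub-permutation of $\pi$ generated by $k$, denoted $g_\pi(k)$, is the permutation obtained by rescaling $s_\pi(k)$ (replacing its entries by $1,2,\dots,|s_\pi(k)|$ in an order-preserving way). For a pattern $\sigma$ and an integer $k\ge 1$, $Av(\sigma;k)$ is the set of permutations $\pi$ for which: $\pi$ avoids $\sigma$ if and only if $g_\pi(k)$ avoids $\sigma$. Equivalently, if $\sigma\prec\pi$ then $\sigma\prec g_\pi(k)$. $Av_n(\sigma;k)=Av(\sigma;k)\cap\mathcal{S}_n$. Thus $\pi\notin Av_n(\sigma;k)$ means $\sigma\prec\pi$ and $\sigma\nprec g_\pi(k)$.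 *)

theory Defs
  imports
    Complex_Main
    "HOL-Library.Sublist"
    "HOL-Combinatorics.Multiset_Permutations"
begin

text \<open>Permutations of \<open>{1..n}\<close> are lists in one-line notation.\<close>

definition perms :: "nat \<Rightarrow> nat list set" where
  "perms n = permutations_of_set {1..n}"

definition order_isomorphic :: "nat list \<Rightarrow> nat list \<Rightarrow> bool" where
  "order_isomorphic xs ys \<longleftrightarrow>
     length xs = length ys \<and>
     (\<forall>i < length xs. \<forall>j < length xs. xs ! i < xs ! j \<longleftrightarrow> ys ! i < ys ! j)"

definition contains_pattern :: "nat list \<Rightarrow> nat list \<Rightarrow> bool"  (infix "\<prec>\<^sub>p" 50) where
  "\<sigma> \<prec>\<^sub>p \<pi> \<longleftrightarrow> (\<exists>xs. subseq xs \<pi> \<and> order_isomorphic xs \<sigma>)"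

text \<open>
  In the library, \<open>subseq\<close> is a not necessarily contiguous subsequence and \<open>sublist\<close> a
  contiguous one. If \<open>k\<close> is an entry of the permutation \<open>\<pi>\<close>, the longest admissible block is
  unique; if \<open>k\<close> is not an entry of \<open>\<pi>\<close>, \<open>s_block\<close> is unspecified.
\<close>

definition s_block :: "nat list \<Rightarrow> nat \<Rightarrow> nat list" where
  "s_block \<pi> k = arg_max length (\<lambda>xs. sublist xs \<pi> \<and> k \<in> set xs \<and> (\<forall>x \<in> set xs. k \<le> x))"

definition rescale :: "nat list \<Rightarrow> nat list" where
  "rescale xs = map (\<lambda>x. card {y \<in> set xs. y \<le> x}) xs"

definition gen_subperm :: "nat list \<Rightarrow> nat \<Rightarrow> nat list" where
  "gen_subperm \<pi> k = rescale (s_block \<pi> k)"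

definition Av :: "nat list \<Rightarrow> nat \<Rightarrow> nat list set" where
  "Av \<sigma> k = {\<pi>. (\<exists>n. \<pi> \<in> perms n) \<and> (\<not> \<sigma> \<prec>\<^sub>p \<pi> \<longleftrightarrow> \<not> \<sigma> \<prec>\<^sub>p gen_subperm \<pi> k)}"

definition catalan :: "nat \<Rightarrow> real" where
  "catalan n = 1 / real (n + 1) * real ((2 * n) choose n)"

end

theory Submission
  imports Defs "HOL-Computational_Algebra.Formal_Power_Series"
begin

text \<open>
  Write \<open>\<pi> = as @ 1 # bs\<close>. The block of 2 is whichever of \<open>as\<close> and \<open>bs\<close> contains 2, so choosing its
  other entries, a 213-avoiding arrangement of it, an arbitrary arrangement of the rest, and the
  side of 1 on which it lies shows that \<open>2 * (\<Sum>i = 1..n - 1. (n - 2 choose (i - 1)) * c\<^sub>i * (n - 1 - i)!)\<close>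
  permutations have a 213-avoiding block. Those among them that avoid 213 altogether are all the
  213-avoiding permutations, so \<open>c\<^sub>n\<close> must be subtracted. The terms \<open>i = n - 3, n - 2, n - 1\<close> are the
  ones written separately in the statement; for \<open>n = 3\<close> the factor \<open>n - 3\<close> removes the first of them.
\<close>

(* Keeps the literal [2, 1, 3] from being rewritten to [2, Suc 0, 3]. *)
declare One_nat_def [simp del]

section \<open>Catalan numbers\<close>

text \<open>The ratio of consecutive central binomial coefficients gives this recurrence, which
  drives the induction for the binomial coefficients of 1/2.\<close>

lemma catalan_Suc: "real (n + 2) * catalan (Suc n) = 2 * (2 * real n + 1) * catalan n"
proof -
  have choose: "real ((2 * m) choose m) = fact (2 * m) / (fact m * fact m)" for m
    by (simp add: binomial_fact mult_2)
  have "real ((2 * Suc n) choose Suc n) * real (Suc n) = 2 * (2 * real n + 1) * real ((2 * n) choose n)"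
    unfolding choose by (simp add: divide_simps) (simp add: algebra_simps)
  then show ?thesis
    unfolding catalan_def by (simp add: field_simps del: mult_Suc_right binomial_Suc_Suc)
qed

text \<open>These are the coefficients of sqrt (1 + x); replacing x by -4x turns them into -2 times
  the Catalan numbers.\<close>

lemma gbinomial_half_Suc:
  "((1 / 2 :: real) gchoose Suc k) = 2 * (- 1) ^ k / 4 ^ Suc k * catalan k"
proof (induction k)
  case 0
  then show ?case by (simp add: catalan_def)
next
  case (Suc k)
  have "((1 / 2 :: real) gchoose Suc (Suc k)) =
      (1 / 2 gchoose Suc k) * (1 / 2 - real (Suc k)) / real (k + 2)"
    by (simp add: gbinomial_prod_rev field_simps)
  also have "\<dots> = 2 * (- 1) ^ Suc k / 4 ^ Suc (Suc k) * (2 * (2 * real k + 1) * catalan k / real (k + 2))"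
    by (simp add: Suc.IH divide_simps) (simp add: algebra_simps)
  also have "2 * (2 * real k + 1) * catalan k / real (k + 2) = catalan (Suc k)"
    using catalan_Suc[of k] by (simp add: field_simps)
  finally show ?case .
qed

text \<open>Comparing coefficients in the square of \<open>sqrt (1 - 4 * x)\<close>.\<close>

lemma catalan_convolution: "(\<Sum>i\<le>n. catalan i * catalan (n - i)) = catalan (Suc n)"
proof -
  let ?g = "\<lambda>k. (1 / 2 :: real) gchoose k"
  have "(\<Sum>k\<le>Suc (Suc n). ?g k * ?g (Suc (Suc n) - k)) = (1 :: real) gchoose Suc (Suc n)"
    using gbinomial_Vandermonde[of "1 / 2 :: real" "1 / 2" "Suc (Suc n)"]
    by (simp add: atMost_atLeast0)
  \<comment> \<open>The two upper arguments 1/2 add up to 1, and 1 choose n + 2 vanishes.\<close>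
  also have "\<dots> = 0"
    using binomial_gbinomial[of 1 "Suc (Suc n)", where ?'a = real] by (simp add: binomial_eq_0)
  \<comment> \<open>As \<open>?g 0 = 1\<close>, the first and the last summand both equal
    \<open>?g (Suc (Suc n))\<close>; the remaining ones form the Catalan convolution up to a
    constant.\<close>
  finally have "0 = 2 * ?g (Suc (Suc n)) + (\<Sum>k\<le>n. ?g (Suc k) * ?g (Suc (n - k)))"
    by (subst (asm) sum.atMost_Suc_shift, subst (asm) sum.atMost_Suc)
       (simp add: Suc_diff_le)
  also have "(\<Sum>k\<le>n. ?g (Suc k) * ?g (Suc (n - k))) =
      (\<Sum>k\<le>n. 4 * (- 1) ^ n / 4 ^ Suc (Suc n) * (catalan k * catalan (n - k)))"
  proof (rule sum.cong)
    fix k assume "k \<in> {..n}"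
    then obtain j where n: "n = k + j" by (auto simp: le_iff_add)
    show "?g (Suc k) * ?g (Suc (n - k)) =
        4 * (- 1) ^ n / 4 ^ Suc (Suc n) * (catalan k * catalan (n - k))"
      by (simp add: gbinomial_half_Suc n power_add field_simps)
  qed simp
  also have "2 * ?g (Suc (Suc n)) = - (4 * (- 1) ^ n / 4 ^ Suc (Suc n)) * catalan (Suc n)"
    by (simp add: gbinomial_half_Suc)
  finally show ?thesis
    by (simp add: sum_distrib_left[symmetric] sum_divide_distrib[symmetric])
qed

section \<open>Splitting a permutation at an entry\<close>

text \<open>Grouping subsets by size turns a sum over the possible entries of a block into a
  binomial sum.\<close>

lemma sum_Pow_card:
  fixes f :: "nat \<Rightarrow> 'a :: comm_semiring_1"
  assumes "finite A"
  shows "(\<Sum>U\<in>Pow A. f (card U)) = (\<Sum>j\<le>card A. of_nat (card A choose j) * f j)"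
proof -
  have "(\<Sum>U\<in>Pow A. f (card U)) = (\<Sum>j\<le>card A. \<Sum>U\<in>{U \<in> Pow A. card U = j}. f (card U))"
    using assms by (subst sum.group) (auto intro: card_mono)
  also have "\<dots> = (\<Sum>j\<le>card A. of_nat (card A choose j) * f j)"
    using assms by (intro sum.cong) (auto simp flip: n_subsets)
  finally show ?thesis .
qed

text \<open>Since \<open>m\<close> occurs exactly once, an arrangement of \<open>S\<close> is
  determined by the set \<open>T\<close> of entries before \<open>m\<close> and the arrangements of
  the two sides. \<open>P\<close> stays arbitrary because the split serves both for avoidance of 213
  and for the block of 2.\<close>

lemma card_permutations_of_set_split:
  assumes "finite S" and "m \<in> S"
  shows "card {xs \<in> permutations_of_set S. P xs} =
    (\<Sum>T\<in>Pow (S - {m}). card {(as, bs) \<in> permutations_of_set T \<times> permutations_of_set (S - {m} - T).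
       P (as @ m # bs)})"
proof -
  let ?R = "\<lambda>T. {(as, bs) \<in> permutations_of_set T \<times> permutations_of_set (S - {m} - T). P (as @ m # bs)}"
  let ?f = "\<lambda>(as, bs). as @ m # bs"
  have fin: "finite (?R T)" for T
    by (rule finite_subset[of _ "permutations_of_set T \<times> permutations_of_set (S - {m} - T)"]) auto
  have "bij_betw ?f (\<Union>T\<in>Pow (S - {m}). ?R T) {xs \<in> permutations_of_set S. P xs}"
    unfolding bij_betw_def
  proof (intro conjI equalityI subsetI)
    show "inj_on ?f (\<Union>T\<in>Pow (S - {m}). ?R T)"
    proof (rule inj_onI, clarify)
      fix as bs as' bs' T T'
      assume "as @ m # bs = as' @ m # bs'" "as \<in> permutations_of_set T" "T \<subseteq> S - {m}"
        "bs \<in> permutations_of_set (S - {m} - T)"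
      moreover from this have "m \<notin> set as" "m \<notin> set bs"
        by (auto simp: permutations_of_set_def)
      ultimately show "as = as' \<and> bs = bs'"
        by (simp add: append_Cons_eq_iff)
    qed
    show "xs \<in> {xs \<in> permutations_of_set S. P xs}" if "xs \<in> ?f ` (\<Union>T\<in>Pow (S - {m}). ?R T)" for xs
      using that assms by (auto simp: permutations_of_set_def)
    show "xs \<in> ?f ` (\<Union>T\<in>Pow (S - {m}). ?R T)" if "xs \<in> {xs \<in> permutations_of_set S. P xs}" for xs
    proof -
      have xs: "set xs = S" "distinct xs" "P xs"
        using that by (auto simp: permutations_of_set_def)
      then obtain as bs where eq: "xs = as @ m # bs"
        using split_list[of m xs] assms by auto
      have "(as, bs) \<in> ?R (set as)" "set as \<in> Pow (S - {m})"
        using xs by (auto simp: permutations_of_set_def eq)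
      then show ?thesis using eq by (force simp: image_iff)
    qed
  qed
  then have "card {xs \<in> permutations_of_set S. P xs} = card (\<Union>T\<in>Pow (S - {m}). ?R T)"
    by (rule bij_betw_same_card[symmetric])
  \<comment> \<open>\<open>T\<close> is recovered as the set of entries of \<open>as\<close>, so the
    pieces are disjoint.\<close>
  also have "\<dots> = (\<Sum>T\<in>Pow (S - {m}). card (?R T))"
    using assms fin by (intro card_UN_disjoint) (auto simp: permutations_of_set_def)
  finally show ?thesis .
qed

section \<open>Permutations avoiding 213\<close>

lemma subseq_imp_set_subset: "subseq xs ys \<Longrightarrow> set xs \<subseteq> set ys"
  by (induction rule: list_emb.induct) auto

lemma contains_pattern_mono: "\<sigma> \<prec>\<^sub>p xs \<Longrightarrow> subseq xs ys \<Longrightarrow> \<sigma> \<prec>\<^sub>p ys"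
  unfolding contains_pattern_def by (blast intro: subseq_order.trans)

lemma contains_213_iff:
  "[2, 1, 3] \<prec>\<^sub>p \<pi> \<longleftrightarrow> (\<exists>b a c. subseq [b, a, c] \<pi> \<and> a < b \<and> b < c)"
proof -
  have "order_isomorphic xs [2, 1, 3] \<longleftrightarrow> (\<exists>b a c. xs = [b, a, c] \<and> a < b \<and> b < c)" for xs
  proof
    assume iso: "order_isomorphic xs [2, 1, 3]"
    then have "length xs = Suc (Suc (Suc 0))" by (simp add: order_isomorphic_def)
    then obtain b a c where "xs = [b, a, c]" by (auto simp: length_Suc_conv)
    then show "\<exists>b a c. xs = [b, a, c] \<and> a < b \<and> b < c"
      using iso by (auto simp: order_isomorphic_def All_less_Suc)
  next
    assume "\<exists>b a c. xs = [b, a, c] \<and> a < b \<and> b < c"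
    then obtain b a c where "xs = [b, a, c]" "a < b" "b < c" by blast
    then show "order_isomorphic xs [2, 1, 3]"
      by (simp add: order_isomorphic_def All_less_Suc)
  qed
  then show ?thesis unfolding contains_pattern_def by auto
qed

text \<open>In a 213 that uses the minimum \<open>m\<close>, \<open>m\<close> must play the 1. An
  occurrence that reaches both sides has its 2 on the left and its 3 on the right, hence an ascent
  across \<open>m\<close>; conversely, such an ascent with \<open>m\<close> in between is a
  213.\<close>

lemma contains_213_split_min:
  assumes "\<forall>x \<in> set as \<union> set bs. m < x"
  shows "[2, 1, 3] \<prec>\<^sub>p as @ m # bs \<longleftrightarrow>
    [2, 1, 3] \<prec>\<^sub>p as \<or> [2, 1, 3] \<prec>\<^sub>p bs \<or> (\<exists>a \<in> set as. \<exists>b \<in> set bs. a < b)"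
proof
  assume "[2, 1, 3] \<prec>\<^sub>p as @ m # bs"
  then obtain b a c where sub: "subseq [b, a, c] (as @ m # bs)" and less: "a < b" "b < c"
    by (auto simp: contains_213_iff)
  from sub obtain us vs where uv: "[b, a, c] = us @ vs" "subseq us as" "subseq vs (m # bs)"
    by (auto simp: subseq_append_iff)
  show "[2, 1, 3] \<prec>\<^sub>p as \<or> [2, 1, 3] \<prec>\<^sub>p bs \<or> (\<exists>a \<in> set as. \<exists>b \<in> set bs. a < b)"
  proof (cases us)
    case Nil
    \<comment> \<open>The 2 of the pattern has a smaller entry after it, so the minimum cannot play
      it.\<close>
    have "b \<noteq> m"
    proof
      assume "b = m"
      then have "a \<in> set bs"
        using uv Nil less by (auto dest!: subseq_imp_set_subset)
      then have "m < a" using assms by blast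
      then show False using less \<open>b = m\<close> by simp
    qed
    then have "subseq [b, a, c] bs" using uv Nil by auto
    then have "[2, 1, 3] \<prec>\<^sub>p bs" unfolding contains_213_iff using less by blast
    then show ?thesis by blast
  next
    case (Cons u us')
    then have u: "u = b" "[a, c] = us' @ vs" using uv by auto
    have b: "b \<in> set as" using uv(2) Cons u by (auto dest: subseq_imp_set_subset)
    show ?thesis
    proof (cases "vs = []")
      case True
      then have "subseq [b, a, c] as" using uv by simp
      then have "[2, 1, 3] \<prec>\<^sub>p as" unfolding contains_213_iff using less by blast
      then show ?thesis ..
    next
      case False
      \<comment> \<open>\<open>vs\<close> is a nonempty suffix of \<open>[a, c]\<close>, so it
        contains the last entry.\<close>
      then have "c \<in> set vs"
        using u(2) by (auto simp: Cons_eq_append_conv)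
      then have "c \<in> set (m # bs)"
        using subseq_imp_set_subset[OF uv(3)] by (rule rev_subsetD)
      moreover have "m < b" using assms b by blast
      ultimately have "c \<in> set bs" using less by simp
      then show ?thesis using b less by auto
    qed
  qed
next
  assume "[2, 1, 3] \<prec>\<^sub>p as \<or> [2, 1, 3] \<prec>\<^sub>p bs \<or> (\<exists>a \<in> set as. \<exists>b \<in> set bs. a < b)"
  then consider "[2, 1, 3] \<prec>\<^sub>p as" | "[2, 1, 3] \<prec>\<^sub>p bs"
    | a b where "a \<in> set as" "b \<in> set bs" "a < b" by blast
  then show "[2, 1, 3] \<prec>\<^sub>p as @ m # bs"
  proof cases
    case 1
    then show ?thesis
      by (rule contains_pattern_mono) (rule sublist_imp_subseq, simp)
  next
    case 2
    have "subseq bs (as @ m # bs)"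
      using sublist_imp_subseq[OF sublist_append_leftI[of bs "as @ [m]"]] by simp
    with 2 show ?thesis by (rule contains_pattern_mono)
  next
    case 3
    then have "subseq ([a] @ [m, b]) (as @ m # bs)"
      by (intro list_emb_append_mono) (auto simp: subseq_singleton_left)
    then have "subseq [a, m, b] (as @ m # bs)" by simp
    moreover have "m < a" using 3(1) assms by blast
    ultimately show ?thesis using 3(3)
      unfolding contains_213_iff by (intro exI[of _ a] exI[of _ m] exI[of _ b] conjI)
  qed
qed

text \<open>Upper sets of a finite linear order form a chain with one member of each size. This
  reduces the choice of the entries left of the minimum to the choice of their number.\<close>

lemma bij_betw_card_upper_sets:
  fixes S :: "'a :: linorder set"
  assumes "finite S"
  shows "bij_betw card {T. T \<subseteq> S \<and> (\<forall>a\<in>T. \<forall>b\<in>S - T. b < a)} {..card S}"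
  unfolding bij_betw_def
proof (intro conjI equalityI subsetI)
  let ?U = "{T. T \<subseteq> S \<and> (\<forall>a\<in>T. \<forall>b\<in>S - T. b < a)}"
  show "inj_on card ?U"
  proof (rule inj_onI)
    fix T T' assume T: "T \<in> ?U" "T' \<in> ?U" "card T = card T'"
    \<comment> \<open>If neither contained the other, an element of each difference would lie below
      the other one.\<close>
    have "T \<subseteq> T' \<or> T' \<subseteq> T"
    proof (rule ccontr)
      assume "\<not> ?thesis"
      then obtain x y where "x \<in> T - T'" "y \<in> T' - T" by blast
      then have "x < y" "y < x" using T by blast+
      then show False by simp
    qed
    moreover have "finite T" "finite T'" using T assms by (auto intro: finite_subset)
    ultimately show "T = T'" using T(3) by (metis card_subset_eq)
  qed
  show "i \<in> {..card S}" if "i \<in> card ` ?U" for i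
    using that assms by (auto intro: card_mono)
  have *: "\<exists>T \<subseteq> S. card T = i \<and> (\<forall>a\<in>T. \<forall>b\<in>S - T. b < a)" if "i \<le> card S" for i
    using assms that
  proof (induction arbitrary: i rule: finite_linorder_max_induct)
    case empty
    then show ?case by simp
  next
    \<comment> \<open>The new element \<open>x\<close> is the maximum, so adding it to an upper set
      of \<open>A\<close> gives an upper set with one more element.\<close>
    case (insert x A)
    show ?case
    proof (cases i)
      case 0
      then show ?thesis by (intro exI[of _ "{}"]) auto
    next
      case (Suc j)
      have x: "x \<notin> A" using insert.hyps by auto
      then have "j \<le> card A" using insert.prems insert.hyps Suc by simp
      then obtain T where T: "T \<subseteq> A" "card T = j" "\<forall>a\<in>T. \<forall>b\<in>A - T. b < a"
        using insert.IH by blast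
      have "finite T" "x \<notin> T" using T x insert.hyps by (auto intro: finite_subset)
      then show ?thesis using T insert.hyps Suc
        by (intro exI[of _ "insert x T"]) auto
    qed
  qed
  show "i \<in> card ` ?U" if "i \<in> {..card S}" for i
  proof -
    have "i \<le> card S" using that by simp
    then obtain T where "T \<subseteq> S" "card T = i" "\<forall>a\<in>T. \<forall>b\<in>S - T. b < a"
      using * by blast
    then show ?thesis by (intro image_eqI[of _ _ T]) simp_all
  qed
qed

text \<open>Split at the minimum: both sides avoid 213 and every left entry exceeds every right
  entry, which yields the Catalan convolution. An arbitrary finite \<open>S\<close> is allowed
  because the sides, and later the block of 2, need not have entries starting at 1.\<close>

lemma card_avoiding_213:
  assumes "finite S"
  shows "real (card {xs \<in> permutations_of_set S. \<not> [2, 1, 3] \<prec>\<^sub>p xs}) = catalan (card S)"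
  using assms
proof (induction S rule: finite_psubset_induct)
  case (psubset S)
  let ?av = "\<lambda>T. {xs \<in> permutations_of_set T. \<not> [2, 1, 3] \<prec>\<^sub>p xs}"
  show ?case
  proof (cases "S = {}")
    case True
    then have "{xs \<in> permutations_of_set S. \<not> [2, 1, 3] \<prec>\<^sub>p xs} = {[]}"
      by (auto simp: contains_213_iff)
    then show ?thesis using True by (simp add: catalan_def)
  next
    case False
    define m where "m = Min S"
    define S' where "S' = S - {m}"
    have m: "m \<in> S"
      using False psubset.hyps(1) by (simp add: m_def)
    have less: "m < x" if "x \<in> S'" for x
    proof -
      have "x \<in> S" "x \<noteq> m" using that by (simp_all add: S'_def)
      then show ?thesis using Min_le[OF psubset.hyps(1)] by (simp add: m_def order_less_le)
    qed
    have fin: "finite S'" and sub: "S' \<subset> S"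
      using psubset.hyps(1) m by (auto simp: S'_def)
    have card: "card S = Suc (card S')"
      unfolding S'_def using psubset.hyps(1) m by (rule card.remove)
    let ?U = "{T. T \<subseteq> S' \<and> (\<forall>a\<in>T. \<forall>b\<in>S' - T. b < a)}"
    have part: "card {(as, bs) \<in> permutations_of_set T \<times> permutations_of_set (S' - T).
          \<not> [2, 1, 3] \<prec>\<^sub>p as @ m # bs} =
        (if T \<in> ?U then card (?av T) * card (?av (S' - T)) else 0)"
      if "T \<subseteq> S'" for T
    proof -
      \<comment> \<open>The two sides share no entry, so \<open>T \<notin> ?U\<close> says exactly
        that some left entry is below some right entry.\<close>
      have "[2, 1, 3] \<prec>\<^sub>p as @ m # bs \<longleftrightarrow>
          [2, 1, 3] \<prec>\<^sub>p as \<or> [2, 1, 3] \<prec>\<^sub>p bs \<or> T \<notin> ?U"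
        if "as \<in> permutations_of_set T" "bs \<in> permutations_of_set (S' - T)" for as bs
      proof -
        have sets: "set as = T" "set bs = S' - T" using that by (auto dest: permutations_of_setD)
        then have "\<forall>x \<in> set as \<union> set bs. m < x" using less \<open>T \<subseteq> S'\<close> by auto
        then show ?thesis
          using \<open>T \<subseteq> S'\<close> by (subst contains_213_split_min) (auto simp: sets not_less le_less)
      qed
      then have "{(as, bs) \<in> permutations_of_set T \<times> permutations_of_set (S' - T).
          \<not> [2, 1, 3] \<prec>\<^sub>p as @ m # bs} = (if T \<in> ?U then ?av T \<times> ?av (S' - T) else {})"
        by auto
      then show ?thesis by (simp add: card_cartesian_product)
    qed
    have "card (?av S) = (\<Sum>T\<in>Pow S'. if T \<in> ?U then card (?av T) * card (?av (S' - T)) else 0)"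
      unfolding card_permutations_of_set_split[OF psubset.hyps(1) m] S'_def[symmetric]
      by (intro sum.cong refl part) simp
    also have "\<dots> = (\<Sum>T\<in>?U. card (?av T) * card (?av (S' - T)))"
      using fin by (intro sum.mono_neutral_cong_right) auto
    finally have "real (card (?av S)) = (\<Sum>T\<in>?U. real (card (?av T)) * real (card (?av (S' - T))))"
      by simp
    also have "\<dots> = (\<Sum>T\<in>?U. catalan (card T) * catalan (card S' - card T))"
    proof (rule sum.cong)
      fix T assume "T \<in> ?U"
      then have T: "T \<subset> S" "S' - T \<subset> S" "card (S' - T) = card S' - card T"
        using sub fin by (auto intro: card_Diff_subset finite_subset)
      then show "real (card (?av T)) * real (card (?av (S' - T))) =
          catalan (card T) * catalan (card S' - card T)"
        using psubset.IH by simp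
    qed simp
    also have "\<dots> = (\<Sum>i\<le>card S'. catalan i * catalan (card S' - i))"
      using sum.reindex_bij_betw[OF bij_betw_card_upper_sets[OF fin],
        of "\<lambda>i. catalan i * catalan (card S' - i)"] .
    finally show ?thesis by (simp add: catalan_convolution card)
  qed
qed

section \<open>The sub-permutation generated by 2\<close>

text \<open>Subsequences of the image are images of subsequences. Monotonicity is asked only on the
  entries because the rank function in \<open>rescale\<close> need not be strict elsewhere.\<close>

lemma contains_pattern_map_strict_mono_on:
  assumes "strict_mono_on (set xs) f"
  shows "\<sigma> \<prec>\<^sub>p map f xs \<longleftrightarrow> \<sigma> \<prec>\<^sub>p xs"
proof -
  have sub: "subseq ys (map f xs) \<longleftrightarrow> (\<exists>zs. subseq zs xs \<and> ys = map f zs)" for ys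
    unfolding subseq_conv_nths by (auto simp: nths_map)
  have iso: "order_isomorphic (map f zs) \<sigma> \<longleftrightarrow> order_isomorphic zs \<sigma>" if "subseq zs xs" for zs
  proof -
    have "set zs \<subseteq> set xs" using that by (rule subseq_imp_set_subset)
    then have "f (zs ! i) < f (zs ! j) \<longleftrightarrow> zs ! i < zs ! j" if "i < length zs" "j < length zs" for i j
      using strict_mono_on_less[OF assms] that by (meson nth_mem subsetD)
    then show ?thesis by (auto simp: order_isomorphic_def)
  qed
  have "\<sigma> \<prec>\<^sub>p map f xs \<longleftrightarrow> (\<exists>zs. subseq zs xs \<and> order_isomorphic (map f zs) \<sigma>)"
    unfolding contains_pattern_def sub by blast
  also have "\<dots> \<longleftrightarrow> \<sigma> \<prec>\<^sub>p xs"
    unfolding contains_pattern_def using iso by blast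
  finally show ?thesis .
qed

lemma contains_pattern_rescale: "\<sigma> \<prec>\<^sub>p rescale xs \<longleftrightarrow> \<sigma> \<prec>\<^sub>p xs"
  unfolding rescale_def
proof (rule contains_pattern_map_strict_mono_on, rule strict_mono_onI)
  fix r s assume "r \<in> set xs" "s \<in> set xs" "r < s"
  then have "{y \<in> set xs. y \<le> r} \<subseteq> {y \<in> set xs. y \<le> s}"
    and "s \<in> {y \<in> set xs. y \<le> s}" "s \<notin> {y \<in> set xs. y \<le> r}" by auto
  then have "{y \<in> set xs. y \<le> r} \<subset> {y \<in> set xs. y \<le> s}" by blast
  then show "card {y \<in> set xs. y \<le> r} < card {y \<in> set xs. y \<le> s}"
    by (intro psubset_card_mono) simp_all
qed

text \<open>\<open>arg_max\<close> compares lengths only; if every admissible block lies inside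
  \<open>ys\<close>, one of maximal length must be \<open>ys\<close> itself.\<close>

lemma s_block_eqI:
  assumes "sublist ys \<pi>" "k \<in> set ys" "\<forall>x \<in> set ys. k \<le> x"
    and "\<And>xs. sublist xs \<pi> \<Longrightarrow> k \<in> set xs \<Longrightarrow> \<forall>x \<in> set xs. k \<le> x \<Longrightarrow> sublist xs ys"
  shows "s_block \<pi> k = ys"
  unfolding s_block_def
proof (rule arg_maxI[where x = ys and f = length and Q = "\<lambda>xs. xs = ys"])
  fix xs
  assume xs: "sublist xs \<pi> \<and> k \<in> set xs \<and> (\<forall>x\<in>set xs. k \<le> x)"
  then show "\<not> length ys < length xs"
    using assms(4) by (auto simp: not_less intro: sublist_length_le)
  assume "\<forall>zs. sublist zs \<pi> \<and> k \<in> set zs \<and> (\<forall>x\<in>set zs. k \<le> x) \<longrightarrow> \<not> length xs < length zs"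
  then have "length ys \<le> length xs" using assms by (simp add: not_less)
  moreover have "sublist xs ys" using assms(4) xs by blast
  ultimately show "xs = ys"
    using subseq_same_length[OF sublist_imp_subseq] sublist_length_le[of xs ys] by simp
next
  show "sublist ys \<pi> \<and> k \<in> set ys \<and> (\<forall>x\<in>set ys. k \<le> x)"
    using assms(1-3) by blast
qed

text \<open>A contiguous block that reaches into both sides would have to include
  \<open>m\<close>.\<close>

lemma sublist_split_cases:
  assumes "sublist xs (as @ m # bs)" "m \<notin> set xs"
  shows "sublist xs as \<or> sublist xs bs"
  using assms by (auto simp: sublist_append sublist_Cons_right prefix_Cons)

text \<open>The only entry below \<open>k\<close> is \<open>m\<close>, so the block of
  \<open>k\<close> fills its whole side of \<open>m\<close>. It is applied with \<open>m = 1\<close>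
  and \<open>k = 2\<close>.\<close>

lemma s_block_split:
  assumes "distinct (as @ m # bs)" "\<forall>x \<in> set as \<union> set bs. k \<le> x" "m < k" "k \<in> set as \<union> set bs"
  shows "s_block (as @ m # bs) k = (if k \<in> set as then as else bs)"
proof (rule s_block_eqI)
  show "sublist (if k \<in> set as then as else bs) (as @ m # bs)"
    using sublist_append_leftI[of bs "as @ [m]"] by auto
  fix xs assume xs: "sublist xs (as @ m # bs)" "k \<in> set xs" "\<forall>x \<in> set xs. k \<le> x"
  then have "sublist xs as \<or> sublist xs bs"
    using assms(3) by (intro sublist_split_cases) auto
  then show "sublist xs (if k \<in> set as then as else bs)"
    using xs(2) assms(1) by (auto dest: set_mono_sublist)
qed (use assms in auto)

lemma card_gen_subperm_2_avoiding_213: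
  assumes "n \<ge> 2"
  shows "real (card {\<pi> \<in> perms n. \<not> [2, 1, 3] \<prec>\<^sub>p gen_subperm \<pi> 2}) =
    2 * fact (n - 2) * (\<Sum>i = 1..n - 1. catalan i / fact (i - 1))"
proof -
  define S where "S = {2..n}"
  let ?av = "\<lambda>T. {xs \<in> permutations_of_set T. \<not> [2, 1, 3] \<prec>\<^sub>p xs}"
  let ?R = "\<lambda>T. {(as, bs) \<in> permutations_of_set T \<times> permutations_of_set (S - T).
      \<not> [2, 1, 3] \<prec>\<^sub>p gen_subperm (as @ 1 # bs) 2}"
  define f where "f T = real (card (?R T))" for T
  have S: "{1..n} - {1} = S" and two: "2 \<in> S" and finS: "finite S"
    using assms by (auto simp: S_def)
  have gen: "[2, 1, 3] \<prec>\<^sub>p gen_subperm (as @ 1 # bs) 2 \<longleftrightarrow> [2, 1, 3] \<prec>\<^sub>p (if 2 \<in> T then as else bs)"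
    if "T \<subseteq> S" "as \<in> permutations_of_set T" "bs \<in> permutations_of_set (S - T)" for as bs T
  proof -
    have sets: "set as = T" "set bs = S - T" "distinct as" "distinct bs"
      using that by (auto dest: permutations_of_setD)
    have "s_block (as @ 1 # bs) 2 = (if 2 \<in> set as then as else bs)"
      by (rule s_block_split) (use that(1) sets two in \<open>auto simp: S_def\<close>)
    then show ?thesis by (simp add: gen_subperm_def contains_pattern_rescale sets)
  qed
  \<comment> \<open>The side containing 2 is the block and contributes a Catalan number; the other
    side is free and contributes a factorial.\<close>
  have f: "f T = (if 2 \<in> T then catalan (card T) * fact (card (S - T))
      else catalan (card (S - T)) * fact (card T))" if "T \<subseteq> S" for T
  proof -
    have fin: "finite T" "finite (S - T)" using that finS by (auto intro: finite_subset)
    have "?R T = (if 2 \<in> T then ?av T \<times> permutations_of_set (S - T)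
        else permutations_of_set T \<times> ?av (S - T))"
      using gen[OF that] by auto
    then show ?thesis
      using fin by (simp add: f_def card_cartesian_product card_avoiding_213 mult.commute)
  qed
  let ?P = "Pow S" and ?Q = "{T \<in> Pow S. 2 \<in> T}"
  have "real (card {\<pi> \<in> perms n. \<not> [2, 1, 3] \<prec>\<^sub>p gen_subperm \<pi> 2}) = sum f ?P"
    unfolding perms_def f_def
    using assms by (subst card_permutations_of_set_split[of _ 1]) (simp_all only: S finite_atLeastAtMost of_nat_sum, auto)
  also have "\<dots> = sum f ?Q + sum f (?P - ?Q)"
    using finS by (intro sum.subset_diff[THEN trans, OF _ _ add.commute]) auto
  \<comment> \<open>Complementation exchanges the two sides of 1; this is the source of the factor
    2.\<close>
  also have "sum f (?P - ?Q) = sum f ?Q"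
    by (rule sum.reindex_bij_witness[of _ "\<lambda>T. S - T" "\<lambda>T. S - T"])
       (use two in \<open>auto simp: f double_diff\<close>)
  \<comment> \<open>\<open>U\<close> collects the entries of the block other than 2, so the block
    has length \<open>Suc (card U)\<close>.\<close>
  also have "sum f ?Q = (\<Sum>U\<in>Pow (S - {2}). catalan (Suc (card U)) * fact (n - 2 - card U))"
  proof (rule sum.reindex_bij_witness[of _ "\<lambda>U. insert 2 U" "\<lambda>T. T - {2}"])
    fix T assume T: "T \<in> ?Q"
    then have "finite T" using finS by (auto intro: finite_subset)
    then have "card T = Suc (card (T - {2}))" using T by (intro card.remove) auto
    moreover have "card (S - T) = n - 1 - card T"
      using T \<open>finite T\<close> by (auto simp: card_Diff_subset S_def)
    ultimately show "catalan (Suc (card (T - {2}))) * fact (n - 2 - card (T - {2})) = f T"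
      using T by (simp add: f)
  qed (use two in auto)
  also have "\<dots> = (\<Sum>j\<le>card (S - {2}). of_nat (card (S - {2}) choose j) * (catalan (Suc j) * fact (n - 2 - j)))"
    using finS by (intro sum_Pow_card) auto
  also have "card (S - {2}) = n - 2"
    using two by (simp add: S_def)
  \<comment> \<open>The factor \<open>fact (n - 2 - j)\<close> cancels against the binomial
    coefficient; afterwards \<open>i = j + 1\<close> is the length of the block.\<close>
  also have "(\<Sum>j\<le>n - 2. of_nat ((n - 2) choose j) * (catalan (Suc j) * fact (n - 2 - j))) =
      (\<Sum>j\<le>n - 2. fact (n - 2) * (catalan (Suc j) / fact j))"
    by (intro sum.cong) (auto simp: binomial_fact)
  also have "\<dots> = fact (n - 2) * (\<Sum>i = 1..n - 1. catalan i / fact (i - 1))"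
    unfolding sum_distrib_left[symmetric]
    by (rule arg_cong[of _ _ "\<lambda>x. _ * x"], rule sum.reindex_bij_witness[of _ "\<lambda>i. i - 1" Suc])
       (use assms in auto)
  finally show ?thesis by simp
qed

text \<open>The block is itself a subsequence of \<open>\<pi>\<close>. Hence avoidance by
  \<open>\<pi>\<close> implies avoidance by the block, and the final subtraction is one of a
  subset.\<close>

lemma contains_213_gen_subperm_2:
  assumes "\<pi> \<in> perms n" "n \<ge> 2" "[2, 1, 3] \<prec>\<^sub>p gen_subperm \<pi> 2"
  shows "[2, 1, 3] \<prec>\<^sub>p \<pi>"
proof -
  have \<pi>: "set \<pi> = {1..n}" using assms(1) by (auto simp: perms_def dest: permutations_of_setD)
  let ?P = "\<lambda>xs. sublist xs \<pi> \<and> 2 \<in> set xs \<and> (\<forall>x\<in>set xs. 2 \<le> x)"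
  have "?P (s_block \<pi> 2)"
    unfolding s_block_def
  \<comment> \<open>The maximum exists: \<open>[2]\<close> is admissible, and lengths are bounded by
    that of \<open>\<pi>\<close>.\<close>
  proof (rule arg_max_natI[where P = ?P and k = "[2]"])
    show "?P [2]"
      using split_list[of 2 \<pi>] \<pi> assms(2) by (auto simp: sublist_def)
    show "\<forall>xs. ?P xs \<longrightarrow> length xs < Suc (length \<pi>)"
      by (auto dest: sublist_length_le)
  qed
  then have "subseq (s_block \<pi> 2) \<pi>" by blast
  then show ?thesis
    using assms(3) unfolding gen_subperm_def contains_pattern_rescale
    by (rule contains_pattern_mono[rotated])
qed

theorem proposition6:
  fixes n :: nat
  assumes "n \<ge> 3"
  shows "real (card (perms n - Av [2, 1, 3] 2)) =
    2 * fact (n - 2) * (\<Sum>i = 1..n - 4. catalan i / fact (i - 1))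
    + 2 * (real n - 2) * (real n - 3) * catalan (n - 3)
    + 2 * (real n - 2) * catalan (n - 2)
    - catalan n + 2 * catalan (n - 1)"
proof -
  let ?G = "{\<pi> \<in> perms n. \<not> [2, 1, 3] \<prec>\<^sub>p gen_subperm \<pi> 2}"
  let ?A = "{\<pi> \<in> perms n. \<not> [2, 1, 3] \<prec>\<^sub>p \<pi>}"
  have sub: "?A \<subseteq> ?G" using contains_213_gen_subperm_2 assms by auto
  have fin: "finite ?G" by (simp add: perms_def)
  have "perms n - Av [2, 1, 3] 2 = ?G - ?A"
    using sub by (auto simp: Av_def)
  then have "real (card (perms n - Av [2, 1, 3] 2)) = real (card ?G) - real (card ?A)"
    using sub fin by (simp add: card_Diff_subset finite_subset of_nat_diff card_mono)
  also have "real (card ?A) = catalan n"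
    using card_avoiding_213[of "{1..n}"] by (simp add: perms_def)
  also have "real (card ?G) = 2 * fact (n - 2) * (\<Sum>i = 1..n - 1. catalan i / fact (i - 1))"
    using assms by (intro card_gen_subperm_2_avoiding_213) simp
  also have "\<dots> = 2 * fact (n - 2) * (\<Sum>i = 1..n - 4. catalan i / fact (i - 1))
    + 2 * (real n - 2) * (real n - 3) * catalan (n - 3)
    + 2 * (real n - 2) * catalan (n - 2) + 2 * catalan (n - 1)"
  \<comment> \<open>Here \<open>n - 4\<close> truncates to 0 and only two summands exist; the factor
    \<open>real n - 3\<close> removes the extra term. Otherwise \<open>n = k + 4\<close> avoids
    truncated subtraction.\<close>
  proof (cases "n = 3")
    case True
    then show ?thesis by (simp add: numeral_2_eq_2)
  next
    case False
    define k where "k = n - 4"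
    have n: "n = k + 4" using False assms by (simp add: k_def)
    have eqs: "n - 1 = Suc (Suc (Suc k))" "n - 2 = Suc (Suc k)" "n - 3 = Suc k" "n - 4 = k"
      "real n = real k + 4"
      by (simp_all add: n)
    have fact2: "(fact (Suc (Suc k)) :: real) = (real k + 2) * ((real k + 1) * fact k)"
      and fact1: "(fact (Suc k) :: real) = (real k + 1) * fact k"
      by (simp_all add: algebra_simps)
    let ?F = "fact (Suc (Suc k)) :: real" and ?S = "\<Sum>i = 1..k. catalan i / fact (i - 1)"
    have "(\<Sum>i = 1..n - 1. catalan i / fact (i - 1)) = ?S + catalan (Suc k) / fact k
        + catalan (Suc (Suc k)) / fact (Suc k) + catalan (Suc (Suc (Suc k))) / ?F"
      by (simp add: eqs del: fact_Suc)
    then have "2 * fact (n - 2) * (\<Sum>i = 1..n - 1. catalan i / fact (i - 1)) =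
        2 * ?F * ?S + 2 * (?F * (catalan (Suc k) / fact k))
        + 2 * (?F * (catalan (Suc (Suc k)) / fact (Suc k)))
        + 2 * (?F * (catalan (Suc (Suc (Suc k))) / ?F))"
      by (simp only: eqs distrib_left mult.assoc)
    \<comment> \<open>The polynomial factors are the quotients of (n - 2)! by (n - 4)! here and by
      (n - 3)! in the next step.\<close>
    also have "?F * (catalan (Suc k) / fact k) = (real n - 2) * (real n - 3) * catalan (n - 3)"
      unfolding fact2 eqs by (simp add: add.commute)
    also have "?F * (catalan (Suc (Suc k)) / fact (Suc k)) = (real n - 2) * catalan (n - 2)"
      unfolding fact2 fact1 eqs by (simp add: add.commute)
    also have "?F * (catalan (Suc (Suc (Suc k))) / ?F) = catalan (n - 1)"
      unfolding eqs by simp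
    finally show ?thesis by (simp only: eqs mult.assoc)
  qed
  finally show ?thesis by simp
qed

end
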